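(* Let $G$ be any simple graph on $n$ vertices and let $J$ be the matching with edge set $\{(i,i') : 1\le i\le n\}$. Then $\chi(G^k)=\chi(G)$ for all integers $k\ge 1$; in particular $\chi_\infty(G,J)=\chi(G)$.
   Context: Let $G$ be a simple graph with vertex set $V(G)=\{v_1,\dots,v_n\}$. Let $K_{n,n}$ be the complete bipartite graph with parts $I_n=\{1,\dots,n\}$ and $I_n'=\{1',\dots,n'\}$; a subgraph $J$ of $K_{n,n}$ with vertex set $I_n\cup I_n'$ is symmetric if $i\sim j'$ iff $j\sim i'$. The self-similar graphs based on $(G,J)$: $G^1=G$; for $k\ge2$, $V(G^k)=V(G)^k$, and $(v_{i_1},\dots,v_{i_k})\sim(v_{j_1},\dots,v_{j_k})$ in $G^k$ iff either (1) $(v_{i_1},\dots,v_{i_{k-1}})=(v_{j_1},\dots,v_{j_{k-1}})$ and $v_{i_k}\sim v_{j_k}$ in $G$, or (2) $(v_{i_1},\dots,v_{i_{k-1}})\sim(v_{j_1},\dots,v_{j_{k-1}})$ in $G^{k-1}$ and $i_k\sim j_k'$ in $J$. The sequence $\chi(G^k)$ is non-decreasing; $\chi_\infty(G,J)$ denotes its limit, with $\chi_\infty(G,J)=\infty$ if it is unbounded. *)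

theory Defs
  imports "Graph_Theory.Graph_Theory" "HOL-Library.Extended_Real"
begin

definition proper_colouring :: "'a pair_pre_digraph \<Rightarrow> ('a \<Rightarrow> nat) \<Rightarrow> bool" where
  "proper_colouring G c \<longleftrightarrow> (\<forall>(x, y) \<in> parcs G. c x \<noteq> c y)"

definition chromatic_number :: "'a pair_pre_digraph \<Rightarrow> nat" where
  "chromatic_number G = (LEAST m. \<exists>c. proper_colouring G c \<and> c ` pverts G \<subseteq> {..<m})"

(* The vertices i and i' of K_{n,n} are Inl i and Inr i. *)

definition K_bip :: "nat \<Rightarrow> (nat + nat) pair_pre_digraph" where
  "K_bip n = \<lparr> pverts = Inl ` {1..n} \<union> Inr ` {1..n},
     parcs = {(Inl i, Inr j) | i j. i \<in> {1..n} \<and> j \<in> {1..n}} \<union>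
             {(Inr j, Inl i) | i j. i \<in> {1..n} \<and> j \<in> {1..n}} \<rparr>"

lemma K_bip: "complete_bipartite_digraph n n (with_proj (K_bip n))"
  unfolding complete_bipartite_digraph_pair_def
  by (intro conjI exI[of _ "Inl ` {1..n}"] exI[of _ "Inr ` {1..n}"])
    (auto simp: K_bip_def card_image)

definition symmetric_bip :: "nat \<Rightarrow> (nat + nat) pair_pre_digraph \<Rightarrow> bool" where
  "symmetric_bip n J \<longleftrightarrow>
     pair_graph J \<and> spanning (with_proj J) (with_proj (K_bip n)) \<and>
     (\<forall>i \<in> {1..n}. \<forall>j \<in> {1..n}. (Inl i, Inr j) \<in> parcs J \<longleftrightarrow> (Inl j, Inr i) \<in> parcs J)"

definition matching_bip :: "nat \<Rightarrow> (nat + nat) pair_pre_digraph" where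
  "matching_bip n = \<lparr> pverts = Inl ` {1..n} \<union> Inr ` {1..n},
     parcs = {(Inl i, Inr i) | i. i \<in> {1..n}} \<union> {(Inr i, Inl i) | i. i \<in> {1..n}} \<rparr>"

lemma symmetric_bip_matching_bip: "symmetric_bip n (matching_bip n)"
proof -
  have 1: "pair_graph (matching_bip n)"
  proof (unfold_locales, goal_cases)
    case 4
    have "parcs (matching_bip n) \<subseteq> pverts (matching_bip n) \<times> pverts (matching_bip n)"
      by (auto simp: matching_bip_def)
    moreover have "finite (pverts (matching_bip n))"
      by (simp add: matching_bip_def)
    ultimately show ?case
      by (blast intro: finite_subset)
  qed (auto simp: matching_bip_def symmetric_def intro!: symI)
  interpret M: pair_graph "matching_bip n" by (fact 1)
  have 2: "wf_digraph (with_proj (K_bip n))"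
    by unfold_locales (auto simp: K_bip_def)
  have "subgraph (with_proj (matching_bip n)) (with_proj (K_bip n))"
    using M.wf_digraph 2
    by (auto simp: subgraph_def compatible_def matching_bip_def K_bip_def)
  then show ?thesis
    using 1 by (auto simp: symmetric_bip_def spanning_def matching_bip_def K_bip_def)
qed

(*
  The vertices of G are labelled v 1, ..., v n with n = card (pverts G). A vertex of the k-th graph,
  a k-tuple of vertices of G, is a list of length k; in particular the first graph is G with each
  vertex x written as [x]. The construction starts at k = 1, and the value at k = 0 is irrelevant.
*)
fun self_similar ::
  "'a pair_pre_digraph \<Rightarrow> (nat \<Rightarrow> 'a) \<Rightarrow> (nat + nat) pair_pre_digraph \<Rightarrow> nat \<Rightarrow> 'a list pair_pre_digraph"
where
  "self_similar G v J 0 = \<lparr> pverts = {}, parcs = {} \<rparr>"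
| "self_similar G v J (Suc 0) =
     \<lparr> pverts = {[x] | x. x \<in> pverts G}, parcs = {([x], [y]) | x y. (x, y) \<in> parcs G} \<rparr>"
| "self_similar G v J (Suc (Suc k)) =
     (let H = self_similar G v J (Suc k); I = {1..card (pverts G)} in
       \<lparr> pverts = {xs. length xs = Suc (Suc k) \<and> set xs \<subseteq> pverts G},
         parcs = {(xs @ [v i], ys @ [v j]) | xs ys i j.
           xs \<in> pverts H \<and> ys \<in> pverts H \<and> i \<in> I \<and> j \<in> I \<and>
           (xs = ys \<and> (v i, v j) \<in> parcs G \<or> (xs, ys) \<in> parcs H \<and> (Inl i, Inr j) \<in> parcs J)} \<rparr>)"

lemma pair_graph_self_similar:
  assumes G: "pair_graph G" and v: "bij_betw v {1..n} (pverts G)" and J: "symmetric_bip n J"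
  shows "pair_graph (self_similar G v J (Suc k))"
    and "pverts (self_similar G v J (Suc k)) = {xs. length xs = Suc k \<and> set xs \<subseteq> pverts G}"
proof -
  interpret G: pair_graph G by (fact G)
  have n: "card (pverts G) = n"
    using bij_betw_same_card[OF v] by simp
  have vin: "v i \<in> pverts G" if "i \<in> {1..n}" for i
    using v that by (auto simp: bij_betw_def)
  have Jsym: "(Inl j, Inr i) \<in> parcs J"
    if "(Inl i, Inr j) \<in> parcs J" "i \<in> {1..n}" "j \<in> {1..n}" for i j
    using J that by (auto simp: symmetric_bip_def)
  have Gsym: "(y, x) \<in> parcs G" if "(x, y) \<in> parcs G" for x y
    using G.pair_sym_arcs that by (auto simp: symmetric_def sym_def)
  have Gl: "(x, x) \<notin> parcs G" for x
    using G.pair_no_loops by fastforce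
  show verts:
    "pverts (self_similar G v J (Suc k)) = {xs. length xs = Suc k \<and> set xs \<subseteq> pverts G}" for k
    by (cases k) (auto simp: Let_def length_Suc_conv)
  have fin: "finite (pverts (self_similar G v J (Suc k)))" for k
    using finite_lists_length_eq[OF G.pair_finite_verts, of "Suc k"]
    by (simp only: verts conj_commute)
  have graphI: "pair_graph (self_similar G v J (Suc k))"
    if "\<And>xs ys. (xs, ys) \<in> parcs (self_similar G v J (Suc k)) \<Longrightarrow>
          xs \<in> pverts (self_similar G v J (Suc k)) \<and> ys \<in> pverts (self_similar G v J (Suc k)) \<and>
          xs \<noteq> ys \<and> (ys, xs) \<in> parcs (self_similar G v J (Suc k))" (is "\<And>xs ys. _ \<Longrightarrow> ?P xs ys") for k
  proof (unfold_locales, goal_cases)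
    case 4
    have "parcs (self_similar G v J (Suc k)) \<subseteq>
        pverts (self_similar G v J (Suc k)) \<times> pverts (self_similar G v J (Suc k))"
      using that by fast
    with fin show ?case
      by (blast intro: finite_subset)
  qed (use fin that in \<open>auto simp: symmetric_def sym_def simp del: self_similar.simps\<close>)
  show "pair_graph (self_similar G v J (Suc k))"
  proof (induction k)
    case 0
    show ?case
      by (rule graphI) (use G.in_arcsD1 G.in_arcsD2 Gl Gsym in auto)
  next
    case (Suc k)
    define H where "H = self_similar G v J (Suc k)"
    interpret H: pair_graph H unfolding H_def by (fact Suc.IH)
    have Hv: "pverts H = {xs. length xs = Suc k \<and> set xs \<subseteq> pverts G}"
      unfolding H_def by (rule verts)
    have Hsym: "(y, x) \<in> parcs H" if "(x, y) \<in> parcs H" for x y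
      using H.pair_sym_arcs that by (auto simp: symmetric_def sym_def)
    have Hl: "(x, x) \<notin> parcs H" for x
      using H.pair_no_loops by fastforce
    have arcs: "parcs (self_similar G v J (Suc (Suc k))) =
        {(xs @ [v i], ys @ [v j]) | xs ys i j. xs \<in> pverts H \<and> ys \<in> pverts H \<and>
           i \<in> {1..n} \<and> j \<in> {1..n} \<and>
           (xs = ys \<and> (v i, v j) \<in> parcs G \<or> (xs, ys) \<in> parcs H \<and> (Inl i, Inr j) \<in> parcs J)}"
      by (simp only: self_similar.simps Let_def H_def[symmetric] n pair_pre_digraph.simps)
    show ?case
    proof (rule graphI)
      fix as bs assume "(as, bs) \<in> parcs (self_similar G v J (Suc (Suc k)))"
      then obtain xs ys i j where *: "as = xs @ [v i]" "bs = ys @ [v j]"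
          "xs \<in> pverts H" "ys \<in> pverts H" "i \<in> {1..n}" "j \<in> {1..n}"
          "xs = ys \<and> (v i, v j) \<in> parcs G \<or> (xs, ys) \<in> parcs H \<and> (Inl i, Inr j) \<in> parcs J"
        unfolding arcs by blast
      have "as \<noteq> bs"
        using * Gl Hl by auto
      moreover have "(bs, as) \<in> parcs (self_similar G v J (Suc (Suc k)))"
        unfolding arcs using * Gsym Hsym Jsym by blast
      ultimately show "as \<in> pverts (self_similar G v J (Suc (Suc k))) \<and>
          bs \<in> pverts (self_similar G v J (Suc (Suc k))) \<and> as \<noteq> bs \<and>
          (bs, as) \<in> parcs (self_similar G v J (Suc (Suc k)))"
        using * vin by (auto simp only: verts) (auto simp: Hv)
    qed
  qed
qed

(* The limit is taken in the order topology of enat, so it is infinite for an unbounded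
   non-decreasing sequence. *)
definition chi_infinity ::
  "'a pair_pre_digraph \<Rightarrow> (nat \<Rightarrow> 'a) \<Rightarrow> (nat + nat) pair_pre_digraph \<Rightarrow> enat" where
  "chi_infinity G v J = lim (\<lambda>k. enat (chromatic_number (self_similar G v J k)))"

end

theory Submission
  imports Defs "HOL-Number_Theory.Cong"
begin

text \<open>
  For the identity matching, \<open>G\<^sup>k\<close> is the \<open>k\<close>-fold Cartesian power of \<open>G\<close>. It contains a copy of
  \<open>G\<close> (vary the last coordinate only), and a proper colouring \<open>c\<close> of \<open>G\<close> with \<open>m\<close> colours gives the
  proper colouring \<open>(x\<^sub>1, \<dots>, x\<^sub>k) \<mapsto> (c x\<^sub>1 + \<dots> + c x\<^sub>k) mod m\<close> of \<open>G\<^sup>k\<close>, since adjacent vertices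
  differ in exactly one coordinate. So \<open>G\<close> and \<open>G\<^sup>k\<close> are \<open>m\<close>-colourable for the same \<open>m\<close>.
\<close>

text \<open>The predicate under the \<open>LEAST\<close> in \<open>chromatic_number\<close>.
  Comparing it for two graphs, possibly on different vertex types, avoids any argument that the
  minimum is attained.\<close>

definition colourable :: "'a pair_pre_digraph \<Rightarrow> nat \<Rightarrow> bool" where
  "colourable G m \<longleftrightarrow> (\<exists>c. proper_colouring G c \<and> c ` pverts G \<subseteq> {..<m})"

lemma chromatic_number_cong:
  assumes "\<And>m. colourable G m \<longleftrightarrow> colourable H m"
  shows "chromatic_number G = chromatic_number H"
  using assms unfolding chromatic_number_def colourable_def by simp

text \<open>Colourings pull back along graph homomorphisms; \<open>f\<close> will be the embedding
  of \<open>G\<close> into its power.\<close>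

lemma colourable_hom:
  assumes "colourable H m"
    and "\<And>x. x \<in> pverts G \<Longrightarrow> f x \<in> pverts H"
    and "\<And>x y. (x, y) \<in> parcs G \<Longrightarrow> (f x, f y) \<in> parcs H"
  shows "colourable G m"
proof -
  obtain c where "proper_colouring H c" "c ` pverts H \<subseteq> {..<m}"
    using assms(1) by (auto simp: colourable_def)
  then have "proper_colouring G (c \<circ> f)" "(c \<circ> f) ` pverts G \<subseteq> {..<m}"
    using assms(2,3) by (fastforce simp: proper_colouring_def)+
  then show ?thesis
    unfolding colourable_def by blast
qed

lemma add_mod_eq_iff:
  fixes a b c m :: nat
  shows "(a + c) mod m = (b + c) mod m \<longleftrightarrow> a mod m = b mod m"
  using cong_add_rcancel_nat[of a c b m] by (simp add: cong_def)

context
  fixes G :: "'a pair_pre_digraph" and n :: nat and v :: "nat \<Rightarrow> 'a"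
  assumes G: "pair_graph G" and v: "bij_betw v {1..n} (pverts G)"
begin

lemma pverts_self_similar_matching:
  "pverts (self_similar G v (matching_bip n) (Suc k)) = {xs. length xs = Suc k \<and> set xs \<subseteq> pverts G}"
  by (rule pair_graph_self_similar(2)[OF G v symmetric_bip_matching_bip])

text \<open>The matching forces \<open>i = j\<close> in arcs of the second kind, and
  \<open>v\<close> maps onto the vertices of \<open>G\<close>, so labels can be traded for vertices.
  The result is the Cartesian product of \<open>H\<close> and \<open>G\<close>.\<close>

lemma parcs_self_similar_matching_Suc:
  fixes k
  defines "H \<equiv> self_similar G v (matching_bip n) (Suc k)"
  shows "parcs (self_similar G v (matching_bip n) (Suc (Suc k))) =
    {(xs @ [x], xs @ [y]) | xs x y. xs \<in> pverts H \<and> (x, y) \<in> parcs G} \<union>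
    {(xs @ [x], ys @ [x]) | xs ys x. (xs, ys) \<in> parcs H \<and> x \<in> pverts G}" (is "?L = ?R")
proof -
  interpret G: pair_graph G by (fact G)
  \<comment> \<open>This puts both ends of an arc of \<open>H\<close> among its vertices, as the
    set-builder form of \<open>?L\<close> requires.\<close>
  interpret H: pair_graph H
    unfolding H_def by (rule pair_graph_self_similar(1)[OF G v symmetric_bip_matching_bip])
  have n: "card (pverts G) = n"
    using bij_betw_same_card[OF v] by simp
  have vI: "pverts G = v ` {1..n}"
    using v by (simp add: bij_betw_def)
  have L: "?L = {(xs @ [v i], ys @ [v j]) | xs ys i j. xs \<in> pverts H \<and> ys \<in> pverts H \<and>
      i \<in> {1..n} \<and> j \<in> {1..n} \<and>
      (xs = ys \<and> (v i, v j) \<in> parcs G \<or>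
        (xs, ys) \<in> parcs H \<and> (Inl i, Inr j) \<in> parcs (matching_bip n))}"
    by (simp only: self_similar.simps Let_def H_def n pair_pre_digraph.simps)
  have M: "(Inl i, Inr j) \<in> parcs (matching_bip n) \<longleftrightarrow> i = j \<and> i \<in> {1..n}" for i j
    by (auto simp: matching_bip_def)
  show ?thesis
  proof
    show "?L \<subseteq> ?R"
      unfolding L M vI by blast
    show "?R \<subseteq> ?L"
    proof
      fix p assume "p \<in> ?R"
      then consider
          (last) xs x y where "p = (xs @ [x], xs @ [y])" "xs \<in> pverts H" "(x, y) \<in> parcs G"
        | (init) xs ys x where "p = (xs @ [x], ys @ [x])" "(xs, ys) \<in> parcs H" "x \<in> pverts G"
        by blast
      then show "p \<in> ?L"
      proof cases
        case last
        then obtain i j where "x = v i" "y = v j" "i \<in> {1..n}" "j \<in> {1..n}"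
          using G.in_arcsD1 G.in_arcsD2 vI by blast
        with last show ?thesis
          unfolding L by blast
      next
        case init
        then obtain i where "x = v i" "i \<in> {1..n}"
          using vI by blast
        with init show ?thesis
          unfolding L M using H.in_arcsD1 H.in_arcsD2 by blast
      qed
    qed
  qed
qed

text \<open>Induction on \<open>k\<close>: along an arc either the last entries or the prefixes
  agree, and the common summand cancels modulo \<open>m\<close>.\<close>

lemma colourable_self_similar_matching:
  assumes "colourable G m"
  shows "colourable (self_similar G v (matching_bip n) (Suc k)) m"
proof -
  interpret G: pair_graph G by (fact G)
  obtain c where c: "proper_colouring G c" "c ` pverts G \<subseteq> {..<m}"
    using assms by (auto simp: colourable_def)
  define C where "C xs = sum_list (map c xs) mod m" for xs
  \<comment> \<open>Colours lie below \<open>m\<close>, so reduction modulo \<open>m\<close> keeps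
    them distinct.\<close>
  have c_arc: "c x mod m \<noteq> c y mod m" if "(x, y) \<in> parcs G" for x y
  proof -
    have "c x < m" "c y < m"
      using that c(2) G.in_arcsD1 G.in_arcsD2 by blast+
    then show ?thesis
      using that c(1) by (auto simp: proper_colouring_def)
  qed
  have "proper_colouring (self_similar G v (matching_bip n) (Suc k)) C"
  proof (induction k)
    case 0
    show ?case
      using c_arc by (auto simp: proper_colouring_def C_def)
  next
    case (Suc k)
    have "C (xs @ [x]) \<noteq> C (xs @ [y])" if "(x, y) \<in> parcs G" for xs x y
      using c_arc[OF that] add_mod_eq_iff[of "c x" "sum_list (map c xs)" m "c y"]
      by (simp add: C_def add.commute)
    moreover have "C (xs @ [x]) \<noteq> C (ys @ [x])"
      if "(xs, ys) \<in> parcs (self_similar G v (matching_bip n) (Suc k))" for xs ys x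
      using Suc.IH that by (auto simp: proper_colouring_def C_def add_mod_eq_iff)
    ultimately show ?case
      unfolding proper_colouring_def parcs_self_similar_matching_Suc by blast
  qed
  moreover have "C xs < m"
    if "xs \<in> pverts (self_similar G v (matching_bip n) (Suc k))" for xs
  proof -
    \<comment> \<open>Tuples are nonempty, so some colour lies below \<open>m\<close>. This gives
      \<open>m > 0\<close>, without which \<open>mod m\<close> would not bound the sum.\<close>
    have "hd xs \<in> pverts G"
      using that unfolding pverts_self_similar_matching by (cases xs) auto
    then have "c (hd xs) < m"
      using c(2) by blast
    then show ?thesis
      by (simp add: C_def)
  qed
  ultimately show ?thesis
    unfolding colourable_def by blast
qed

lemma colourable_of_self_similar_matching:
  assumes "colourable (self_similar G v (matching_bip n) (Suc k)) m"
  shows "colourable G m"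
proof -
  interpret G: pair_graph G by (fact G)
  \<comment> \<open>If \<open>G\<close> is empty, \<open>v 1\<close> is arbitrary; a given vertex
    \<open>x\<close> ensures \<open>n \<ge> 1\<close>.\<close>
  have v1: "v 1 \<in> pverts G" if "x \<in> pverts G" for x
  proof -
    have vI: "pverts G = v ` {1..n}"
      using v by (simp add: bij_betw_def)
    with that have "1 \<in> {1..n}"
      by auto
    with vI show ?thesis
      by blast
  qed
  show ?thesis
  \<comment> \<open>The copy of \<open>G\<close> freezes the first \<open>k\<close> coordinates at
    \<open>v 1\<close>.\<close>
  proof (rule colourable_hom[OF assms, where f = "\<lambda>x. replicate k (v 1) @ [x]"])
    show "replicate k (v 1) @ [x] \<in> pverts (self_similar G v (matching_bip n) (Suc k))"
      if "x \<in> pverts G" for x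
      using that v1 by (auto simp: pverts_self_similar_matching)
    show "(replicate k (v 1) @ [x], replicate k (v 1) @ [y])
        \<in> parcs (self_similar G v (matching_bip n) (Suc k))"
      if "(x, y) \<in> parcs G" for x y
    proof (cases k)
      case 0
      then show ?thesis
        using that by simp
    next
      case (Suc l)
      have "replicate k (v 1) \<in> pverts (self_similar G v (matching_bip n) k)"
        using v1 G.in_arcsD1[OF that] unfolding Suc pverts_self_similar_matching by auto
      with that show ?thesis
        unfolding Suc parcs_self_similar_matching_Suc by blast
    qed
  qed
qed

end

theorem theorem3p1:
  fixes G :: "'a pair_pre_digraph" and n :: nat and v :: "nat \<Rightarrow> 'a"
  assumes "pair_graph G"
    and "bij_betw v {1..n} (pverts G)"
  shows "(\<forall>k\<ge>1. chromatic_number (self_similar G v (matching_bip n) k) = chromatic_number G) \<and>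
    chi_infinity G v (matching_bip n) = enat (chromatic_number G)"
proof -
  have "chromatic_number (self_similar G v (matching_bip n) (Suc k)) = chromatic_number G" for k
    using colourable_self_similar_matching[OF assms] colourable_of_self_similar_matching[OF assms]
    by (blast intro: chromatic_number_cong)
  then have *: "chromatic_number (self_similar G v (matching_bip n) k) = chromatic_number G"
    if "k \<ge> 1" for k
    using that by (cases k) auto
  have "(\<lambda>k. enat (chromatic_number (self_similar G v (matching_bip n) k)))
      \<longlonglongrightarrow> enat (chromatic_number G)"
    \<comment> \<open>Index 0 is the empty graph, with chromatic number 0; the sequence is constant
      from index 1 on.\<close>
    by (rule tendsto_eventually, rule eventually_sequentiallyI[of 1]) (simp only: *)
  then have "chi_infinity G v (matching_bip n) = enat (chromatic_number G)"
    unfolding chi_infinity_def by (rule limI)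
  with * show ?thesis
    by blast
qed

end
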